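(* Consider the $\theta$-implicit finite difference scheme $$G^{k+1}Y^{k+1}=H^kY^k+\tau F^k,\qquad k=0,\dots,N_\tau-1,$$ with $G^k,H^k,F^k$ as defined in the context. 1. For $\theta\in[0,1)$ the scheme is stable in the maximum norm if the time step $\tau$ satisfies $$\tau\le\frac{1}{(1-\theta)\eta},\qquad\text{where}\quad \eta=2\max\{a^F,a^M\}\Big(\frac1{h_x^2}+\frac1{h_y^2}\Big)+\frac{\overline v_0}{h_x}.$$ 2. For $\theta=1$ the scheme is unconditionally stable in the maximum norm, i.e., stable for any $\tau>0$. In both cases the constants $C_0,C_g$ in the definition of stability (see context) can be chosen as $C_0=1$ and $C_g=C_BT$, where $C_B=\max\{\|B^P\|_\infty,\|B^N\|_\infty\}$.
   Context: Parameters. $T,l_x,l_y>0$; positive constants $\rho^M,\kappa^M,c_p^M$ (medium) and $\rho^F,\kappa^F,c_p^F$ (fluid); $a^M=\frac{\kappa^M}{\rho^M c_p^M}$, $a^F=\frac{\kappa^F}{\rho^F c_p^F}$; $\lambda^G>0$; $\overline v_0>0$. The fluid velocity $v_0:[0,T]\to\{0,\overline v_0\}$ is piecewise constant; the pump is "on" at time $t$ if $v_0(t)=\overline v_0$ and "off" if $v_0(t)=0$. Put $\psi^F=\frac{\kappa^F}{\kappa^F+\kappa^M}$, $\psi^M=1-\psi^F$. Grid. $h_x=l_x/N_x$, $h_y=l_y/N_y$ with positive integers $N_x\ge 3$, $N_y$; grid points $(x_i,y_j)=(ih_x,jh_y)$, $0\le i\le N_x$, $0\le j\le N_y$. There are $n_P\in\mathbb{N}$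 straight horizontal pipe heat exchangers crossing the rectangle $(0,l_x)\times(0,l_y)$, in which the fluid moves in positive $x$-direction (with velocity $v_0(t)(1,0)^\top$). Each row index $j\in\{1,\dots,N_y-1\}$ is a medium row, a fluid row or an interface row. From bottom to top the rows form: a nonempty layer of medium rows, then, repeated $n_P$ times, one lower interface row, a nonempty layer of fluid rows, one upper interface row, and a nonempty layer of medium rows. Let $\mathcal J$ be the set of non-interface rows, $q=|\mathcal J|=N_y-2n_P-1$, $n=(N_x-1)q$. The unknown vector $Y(t)\in\mathbb{R}^n$ has entries $Y_l=Q_{ij}$, $1\le i\le N_x-1$, $j\in\mathcal J$, where $l=\mathcal K(i,j)=(i-1)q+(\text{position of } j \text{ in the increasing ordering of } \mathcal J)$. Semi-discrete scheme. For $1\le i\le N_x-1$, $j\in\mathcal J$, $$\frac{dQ_{ij}}{dt}=\alpha_j^{+}Q_{i+1,j}+\alpha_j^{-}Q_{i-1,j}+\beta_jQ_{i,j+1}+\beta_jQ_{i,j-1}+\gamma_jQ_{ij},$$ where for a medium row $\alpha_j^{\pm}=\frac{a^M}{h_x^2}$, $\beta_j=\frac{a^M}{h_y^2}$, $\gamma_j=-2a^M\big(\frac1{h_x^2}+\frac1{h_y^2}\big)$, and for a fluid row $\alpha_j^+=\frac{a^F}{h_x^2}$, $\alpha_j^-=\frac{a^F}{h_x^2}+\frac{v_0(t)}{h_x}$, $\beta_j=\frac{a^F}{h_y^2}$, $\gamma_j=-2a^F\big(\frac1{h_x^2}+\frac1{h_y^2}\big)-\frac{v_0(t)}{h_x}$.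 Boundary and interface values occurring on the right-hand side are eliminated by substituting: - top: $Q_{i,N_y}=Q_{i,N_y-1}$; - bottom: $Q_{i0}=\frac{\kappa^M}{\kappa^M+\lambda^Gh_y}Q_{i1}+\frac{\lambda^Gh_y}{\kappa^M+\lambda^Gh_y}Q^G(t)$; - right boundary (all $j\in\mathcal J$): $Q_{N_x,j}=Q_{N_x-1,j}$; - left boundary, medium row $j$: $Q_{0j}=Q_{1j}$; - left boundary (inlet), fluid row $j$: $Q_{0j}=Q^I(t)$ if the pump is on, $Q_{0j}=Q_{1j}$ if the pump is off; - lower interface row $j$: $Q_{ij}=\psi^FQ_{i,j+1}+\psi^MQ_{i,j-1}$; - upper interface row $j$: $Q_{ij}=\psi^FQ_{i,j-1}+\psi^MQ_{i,j+1}$. Here $Q^I(t)$ (inlet temperature) and $Q^G(t)$ (underground temperature) are given real functions. The resulting linear ODE system is written $\frac{dY}{dt}=A(t)Y+B(t)g(t)$, where $A(t)\in\mathbb{R}^{n\times n}$ collects the coefficients of the unknowns, $g(t)=(Q^I(t),Q^G(t))^\top$ if the pump is on and $g(t)=(0,Q^G(t))^\top$ if it is off, and $B(t)\in\mathbb{R}^{n\times2}$ has entries $B_{l1}=\frac{a^F}{h_x^2}+\frac{\overline v_0}{h_x}$ if the pump is on and $0$ if it is off, for $l=\mathcal K(1,j)$ with $j$ a fluid row; $B_{l2}=\frac{\lambda^Gh_y}{\kappa^M+\lambda^Gh_y}\cdot\frac{a^M}{h_y^2}$ for $l=\mathcal K(i,1)$, $1\le i\le N_x-1$; all other entries zero.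 The matrices depend on $t$ only through $v_0(t)$; $A^P,B^P$ denote their values when the pump is on ($v_0=\overline v_0$) and $A^N,B^N$ their values when it is off ($v_0=0$). Full discretization. $N_\tau\ge1$ is an integer, $\tau=T/N_\tau$, $t_k=k\tau$, and $A^k=A(t_k)$, $B^k=B(t_k)$, $g^k=g(t_k)$ for $k=0,\dots,N_\tau$. For a weight $\theta\in[0,1]$ put $G^k=\mathbb{I}_n-\tau\theta A^k$, $H^k=\mathbb{I}_n+\tau(1-\theta)A^k$, $F^k=\theta B^{k+1}g^{k+1}+(1-\theta)B^kg^k$, where $\mathbb{I}_n$ is the identity matrix; $Y^0\in\mathbb{R}^n$ is a given initial value. Norms and stability. $\|X\|_\infty=\max_i|X_i|$ for vectors and $\|M\|_\infty=\max_i\sum_j|M_{ij}|$ for matrices. The scheme is stable in the maximum norm if there exist constants $C_0,C_g>0$ such that $\|Y^k\|_\infty\le C_0\|Y^0\|_\infty+C_g\max_{0\le j\le k}\|g^j\|_\infty$ for $k=1,\dots,N_\tau$ (for all input data $Y^0$, $g$). *)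

theory Defs
  imports Complex_Main "Jordan_Normal_Form.Matrix"
begin

section \<open>Geometry, physical data and grid\<close>

datatype row_type = Medium | Fluid | Lower_Interface | Upper_Interface

text \<open>\<open>pipe_layout p rs\<close>: \<open>rs\<close> lists the types of the grid rows \<open>1, \<dots>, N\<^sub>y - 1\<close> from bottom to
  top in an arrangement with \<open>p\<close> pipes.\<close>

inductive pipe_layout :: "nat \<Rightarrow> row_type list \<Rightarrow> bool" where
  no_pipe: "m > 0 \<Longrightarrow> pipe_layout 0 (replicate m Medium)"
| add_pipe: "pipe_layout p rs \<Longrightarrow> f > 0 \<Longrightarrow> m > 0 \<Longrightarrow>
    pipe_layout (Suc p)
      (rs @ [Lower_Interface] @ replicate f Fluid @ [Upper_Interface] @ replicate m Medium)"

record heat_exchanger =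
  horizon :: real    \<comment> \<open>\<open>T\<close>\<close>
  len_x :: real
  len_y :: real
  rho_M :: real
  kappa_M :: real
  cp_M :: real
  rho_F :: real
  kappa_F :: real
  cp_F :: real
  lambda_G :: real
  v_bar :: real
  v0 :: "real \<Rightarrow> real"
  Nx :: nat
  Ny :: nat
  nP :: nat
  row_kind :: "nat \<Rightarrow> row_type"    \<comment> \<open>relevant on \<open>{1..<Ny}\<close> only\<close>

text \<open>Values at the finitely many breakpoints are left unconstrained.\<close>

definition piecewise_constant_on :: "real \<Rightarrow> real \<Rightarrow> (real \<Rightarrow> real) \<Rightarrow> bool" where
  "piecewise_constant_on a b f \<longleftrightarrow>
    (\<exists>(m::nat) (s::nat \<Rightarrow> real). s 0 = a \<and> s m = b \<and> (\<forall>r<m. s r < s (Suc r)) \<and>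
       (\<forall>r<m. \<exists>c. \<forall>t. s r < t \<and> t < s (Suc r) \<longrightarrow> f t = c))"

definition valid_heat_exchanger :: "heat_exchanger \<Rightarrow> bool" where
  "valid_heat_exchanger S \<longleftrightarrow>
     horizon S > 0 \<and> len_x S > 0 \<and> len_y S > 0 \<and>
     rho_M S > 0 \<and> kappa_M S > 0 \<and> cp_M S > 0 \<and>
     rho_F S > 0 \<and> kappa_F S > 0 \<and> cp_F S > 0 \<and>
     lambda_G S > 0 \<and> v_bar S > 0 \<and>
     (\<forall>t\<in>{0..horizon S}. v0 S t \<in> {0, v_bar S}) \<and>
     piecewise_constant_on 0 (horizon S) (v0 S) \<and>
     Nx S \<ge> 3 \<and> Ny S \<ge> 1 \<and>
     pipe_layout (nP S) (map (row_kind S) [1..<Ny S])"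

definition a_M :: "heat_exchanger \<Rightarrow> real" where
  "a_M S = kappa_M S / (rho_M S * cp_M S)"

definition a_F :: "heat_exchanger \<Rightarrow> real" where
  "a_F S = kappa_F S / (rho_F S * cp_F S)"

definition psi_F :: "heat_exchanger \<Rightarrow> real" where
  "psi_F S = kappa_F S / (kappa_F S + kappa_M S)"

definition psi_M :: "heat_exchanger \<Rightarrow> real" where
  "psi_M S = 1 - psi_F S"

definition hx :: "heat_exchanger \<Rightarrow> real" where
  "hx S = len_x S / real (Nx S)"

definition hy :: "heat_exchanger \<Rightarrow> real" where
  "hy S = len_y S / real (Ny S)"

definition eta :: "heat_exchanger \<Rightarrow> real" where
  "eta S = 2 * max (a_F S) (a_M S) * (1 / (hx S)\<^sup>2 + 1 / (hy S)\<^sup>2) + v_bar S / hx S"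


section \<open>Enumeration of the unknowns\<close>

definition unknown_rows :: "heat_exchanger \<Rightarrow> nat set" where
  "unknown_rows S = {j. 1 \<le> j \<and> j < Ny S \<and> row_kind S j \<in> {Medium, Fluid}}"

definition q_rows :: "heat_exchanger \<Rightarrow> nat" where
  "q_rows S = card (unknown_rows S)"

definition n_unknowns :: "heat_exchanger \<Rightarrow> nat" where
  "n_unknowns S = (Nx S - 1) * q_rows S"

text \<open>Vector and matrix indices of \<open>Jordan_Normal_Form\<close> start at 0, hence \<open>Kidx S i j = \<K>(i,j) - 1\<close>;
  \<open>node S\<close> is the inverse of this enumeration (see \<open>Kidx_node\<close> and \<open>node_Kidx\<close> below).\<close>

definition Kidx :: "heat_exchanger \<Rightarrow> nat \<Rightarrow> nat \<Rightarrow> nat" where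
  "Kidx S i j = (i - 1) * q_rows S + card {j' \<in> unknown_rows S. j' < j}"

definition node :: "heat_exchanger \<Rightarrow> nat \<Rightarrow> nat \<times> nat" where
  "node S l = (l div q_rows S + 1, sorted_list_of_set (unknown_rows S) ! (l mod q_rows S))"


section \<open>Semi-discrete scheme\<close>

text \<open>Throughout, \<open>v\<close> is the current fluid velocity, \<open>0\<close> or \<open>v_bar S\<close>; the pump is on iff
  \<open>v = v_bar S\<close>. The function \<open>Q\<close> carries the unknowns; \<open>grid_value\<close> extends it to the boundary and
  interface nodes that occur in the difference equations.\<close>

definition grid_value ::
    "heat_exchanger \<Rightarrow> real \<Rightarrow> real \<Rightarrow> real \<Rightarrow> (nat \<Rightarrow> nat \<Rightarrow> real) \<Rightarrow> nat \<Rightarrow> nat \<Rightarrow> real" where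
  "grid_value S v QI QG Q i j =
    (if j = Ny S then Q i (Ny S - 1)
     else if j = 0 then
       kappa_M S / (kappa_M S + lambda_G S * hy S) * Q i 1 +
       lambda_G S * hy S / (kappa_M S + lambda_G S * hy S) * QG
     else if i = Nx S then Q (Nx S - 1) j
     else if i = 0 then (if row_kind S j = Fluid \<and> v = v_bar S then QI else Q 1 j)
     else (case row_kind S j of
         Lower_Interface \<Rightarrow> psi_F S * Q i (j + 1) + psi_M S * Q i (j - 1)
       | Upper_Interface \<Rightarrow> psi_F S * Q i (j - 1) + psi_M S * Q i (j + 1)
       | _ \<Rightarrow> Q i j))"

definition diffusivity :: "heat_exchanger \<Rightarrow> nat \<Rightarrow> real" where
  "diffusivity S j = (if row_kind S j = Fluid then a_F S else a_M S)"

definition alpha_plus :: "heat_exchanger \<Rightarrow> nat \<Rightarrow> real" where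
  "alpha_plus S j = diffusivity S j / (hx S)\<^sup>2"

definition alpha_minus :: "heat_exchanger \<Rightarrow> real \<Rightarrow> nat \<Rightarrow> real" where
  "alpha_minus S v j = diffusivity S j / (hx S)\<^sup>2 + (if row_kind S j = Fluid then v / hx S else 0)"

definition beta :: "heat_exchanger \<Rightarrow> nat \<Rightarrow> real" where
  "beta S j = diffusivity S j / (hy S)\<^sup>2"

definition gamma :: "heat_exchanger \<Rightarrow> real \<Rightarrow> nat \<Rightarrow> real" where
  "gamma S v j = - 2 * diffusivity S j * (1 / (hx S)\<^sup>2 + 1 / (hy S)\<^sup>2) -
     (if row_kind S j = Fluid then v / hx S else 0)"

definition rhs ::
    "heat_exchanger \<Rightarrow> real \<Rightarrow> real \<Rightarrow> real \<Rightarrow> (nat \<Rightarrow> nat \<Rightarrow> real) \<Rightarrow> nat \<times> nat \<Rightarrow> real" where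
  "rhs S v QI QG Q = (\<lambda>(i, j).
     alpha_plus S j * grid_value S v QI QG Q (i + 1) j +
     alpha_minus S v j * grid_value S v QI QG Q (i - 1) j +
     beta S j * grid_value S v QI QG Q i (j + 1) +
     beta S j * grid_value S v QI QG Q i (j - 1) +
     gamma S v j * Q i j)"

text \<open>The coefficient of the unknown \<open>Y\<^sub>m\<close> in the \<open>l\<close>-th equation is read off by inserting the
  \<open>m\<close>-th unit vector for the unknowns and zero for the data; see \<open>rhs_eq_matrix_form\<close> below.\<close>

definition A_mat :: "heat_exchanger \<Rightarrow> real \<Rightarrow> real mat" where
  "A_mat S v = mat (n_unknowns S) (n_unknowns S)
     (\<lambda>(l, m). rhs S v 0 0 (\<lambda>i j. unit_vec (n_unknowns S) m $ Kidx S i j) (node S l))"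

definition B_mat :: "heat_exchanger \<Rightarrow> real \<Rightarrow> real mat" where
  "B_mat S v = mat (n_unknowns S) 2 (\<lambda>(l, c).
     if c = 0 then
       (if v = v_bar S \<and> (\<exists>j\<in>unknown_rows S. row_kind S j = Fluid \<and> l = Kidx S 1 j)
        then a_F S / (hx S)\<^sup>2 + v_bar S / hx S else 0)
     else
       (if \<exists>i\<in>{1..Nx S - 1}. l = Kidx S i 1
        then lambda_G S * hy S / (kappa_M S + lambda_G S * hy S) * (a_M S / (hy S)\<^sup>2) else 0))"

definition g_vec :: "heat_exchanger \<Rightarrow> real \<Rightarrow> real \<Rightarrow> real \<Rightarrow> real vec" where
  "g_vec S v QI QG = vec_of_list [if v = v_bar S then QI else 0, QG]"


section \<open>Full discretization\<close>

definition tau :: "heat_exchanger \<Rightarrow> nat \<Rightarrow> real" where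
  "tau S N = horizon S / real N"

definition time :: "heat_exchanger \<Rightarrow> nat \<Rightarrow> nat \<Rightarrow> real" where
  "time S N k = real k * tau S N"

definition A_step :: "heat_exchanger \<Rightarrow> nat \<Rightarrow> nat \<Rightarrow> real mat" where
  "A_step S N k = A_mat S (v0 S (time S N k))"

definition B_step :: "heat_exchanger \<Rightarrow> nat \<Rightarrow> nat \<Rightarrow> real mat" where
  "B_step S N k = B_mat S (v0 S (time S N k))"

definition g_step ::
    "heat_exchanger \<Rightarrow> nat \<Rightarrow> (real \<Rightarrow> real) \<Rightarrow> (real \<Rightarrow> real) \<Rightarrow> nat \<Rightarrow> real vec" where
  "g_step S N QI QG k =
     g_vec S (v0 S (time S N k)) (QI (time S N k)) (QG (time S N k))"

definition G_step :: "heat_exchanger \<Rightarrow> nat \<Rightarrow> real \<Rightarrow> nat \<Rightarrow> real mat" where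
  "G_step S N \<theta> k = 1\<^sub>m (n_unknowns S) - (tau S N * \<theta>) \<cdot>\<^sub>m A_step S N k"

definition H_step :: "heat_exchanger \<Rightarrow> nat \<Rightarrow> real \<Rightarrow> nat \<Rightarrow> real mat" where
  "H_step S N \<theta> k = 1\<^sub>m (n_unknowns S) + (tau S N * (1 - \<theta>)) \<cdot>\<^sub>m A_step S N k"

definition F_step ::
    "heat_exchanger \<Rightarrow> nat \<Rightarrow> real \<Rightarrow> (real \<Rightarrow> real) \<Rightarrow> (real \<Rightarrow> real) \<Rightarrow> nat \<Rightarrow> real vec" where
  "F_step S N \<theta> QI QG k =
     \<theta> \<cdot>\<^sub>v (B_step S N (k + 1) *\<^sub>v g_step S N QI QG (k + 1)) +
     (1 - \<theta>) \<cdot>\<^sub>v (B_step S N k *\<^sub>v g_step S N QI QG k)"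

definition theta_scheme ::
    "heat_exchanger \<Rightarrow> nat \<Rightarrow> real \<Rightarrow> (real \<Rightarrow> real) \<Rightarrow> (real \<Rightarrow> real) \<Rightarrow> (nat \<Rightarrow> real vec) \<Rightarrow> bool" where
  "theta_scheme S N \<theta> QI QG Y \<longleftrightarrow>
     (\<forall>k\<le>N. Y k \<in> carrier_vec (n_unknowns S)) \<and>
     (\<forall>k<N. G_step S N \<theta> (k + 1) *\<^sub>v Y (k + 1) =
        H_step S N \<theta> k *\<^sub>v Y k + tau S N \<cdot>\<^sub>v F_step S N \<theta> QI QG k)"


section \<open>Norms and stability\<close>

definition vec_norm_inf :: "real vec \<Rightarrow> real" where
  "vec_norm_inf x = Max ((\<lambda>i. \<bar>x $ i\<bar>) ` {0..<dim_vec x})"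

definition mat_norm_inf :: "real mat \<Rightarrow> real" where
  "mat_norm_inf M = Max ((\<lambda>i. \<Sum>j = 0..<dim_col M. \<bar>M $$ (i, j)\<bar>) ` {0..<dim_row M})"

definition C_B :: "heat_exchanger \<Rightarrow> real" where
  "C_B S = max (mat_norm_inf (B_mat S (v_bar S))) (mat_norm_inf (B_mat S 0))"

text \<open>No solvability assumption is needed: applied to zero data, the bound forces every
  \<open>G_step S N \<theta> k\<close> with \<open>1 \<le> k \<le> N\<close> to be nonsingular (consider the last singular one).\<close>

definition max_norm_stable_with :: "heat_exchanger \<Rightarrow> nat \<Rightarrow> real \<Rightarrow> real \<Rightarrow> real \<Rightarrow> bool" where
  "max_norm_stable_with S N \<theta> C0 Cg \<longleftrightarrow> C0 > 0 \<and> Cg > 0 \<and>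
     (\<forall>QI QG Y. theta_scheme S N \<theta> QI QG Y \<longrightarrow>
        (\<forall>k\<in>{1..N}. vec_norm_inf (Y k) \<le>
           C0 * vec_norm_inf (Y 0) +
           Cg * Max ((\<lambda>j. vec_norm_inf (g_step S N QI QG j)) ` {0..k})))"

definition max_norm_stable :: "heat_exchanger \<Rightarrow> nat \<Rightarrow> real \<Rightarrow> bool" where
  "max_norm_stable S N \<theta> \<longleftrightarrow> (\<exists>C0 Cg. max_norm_stable_with S N \<theta> C0 Cg)"


section \<open>Consistency of the encoding\<close>

lemma pipe_layout_count:
  "pipe_layout p rs \<Longrightarrow> length (filter (\<lambda>r. r \<in> {Medium, Fluid}) rs) + 2 * p = length rs"
  by (induction rule: pipe_layout.induct) auto

lemma pipe_layout_neighbours: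
  assumes "pipe_layout p rs"
  shows "rs \<noteq> [] \<and> rs ! 0 = Medium \<and> rs ! (length rs - 1) = Medium \<and>
    (\<forall>k<length rs. (rs ! k = Lower_Interface \<longrightarrow>
        0 < k \<and> k + 1 < length rs \<and> rs ! (k - 1) = Medium \<and> rs ! (k + 1) = Fluid) \<and>
      (rs ! k = Upper_Interface \<longrightarrow>
        0 < k \<and> k + 1 < length rs \<and> rs ! (k - 1) = Fluid \<and> rs ! (k + 1) = Medium))"
  using assms
proof (induction rule: pipe_layout.induct)
  case (no_pipe m)
  then show ?case by auto
next
  case (add_pipe p rs f m)
  let ?ts = "rs @ [Lower_Interface] @ replicate f Fluid @ [Upper_Interface] @ replicate m Medium"
  let ?L = "length rs"
  have len: "length ?ts = ?L + f + m + 2" by simp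
  have n1: "?ts ! k = rs ! k" if "k < ?L" for k using that by (simp add: nth_append)
  have n2: "?ts ! ?L = Lower_Interface" by (simp add: nth_append)
  have n3: "?ts ! k = Fluid" if "?L < k" "k < ?L + f + 1" for k
    using that by (auto simp: nth_append nth_Cons')
  have n4: "?ts ! (?L + f + 1) = Upper_Interface" by (auto simp: nth_append nth_Cons')
  have n5: "?ts ! k = Medium" if "?L + f + 1 < k" "k < ?L + f + m + 2" for k
    using that by (auto simp: nth_append nth_Cons')
  have L0: "0 < ?L" using add_pipe.IH by simp
  have *: "(?ts ! k = Lower_Interface \<longrightarrow>
        0 < k \<and> k + 1 < length ?ts \<and> ?ts ! (k - 1) = Medium \<and> ?ts ! (k + 1) = Fluid) \<and>
      (?ts ! k = Upper_Interface \<longrightarrow>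
        0 < k \<and> k + 1 < length ?ts \<and> ?ts ! (k - 1) = Fluid \<and> ?ts ! (k + 1) = Medium)"
    if kl: "k < length ?ts" for k
  proof -
    consider "k < ?L" | "k = ?L" | "?L < k" "k < ?L + f + 1" | "k = ?L + f + 1"
      | "?L + f + 1 < k" "k < ?L + f + m + 2"
      using kl len by linarith
    then show ?thesis
    proof cases
      case 1
      have "(rs ! k = Lower_Interface \<longrightarrow>
          0 < k \<and> k + 1 < ?L \<and> rs ! (k - 1) = Medium \<and> rs ! (k + 1) = Fluid) \<and>
        (rs ! k = Upper_Interface \<longrightarrow>
          0 < k \<and> k + 1 < ?L \<and> rs ! (k - 1) = Fluid \<and> rs ! (k + 1) = Medium)"
        using add_pipe.IH 1 by blast
      with 1 show ?thesis using n1[of k] n1[of "k - 1"] n1[of "k + 1"] len by auto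
    next
      case 2
      with n2 n1[of "?L - 1"] n3[of "?L + 1"] add_pipe len L0 show ?thesis by auto
    next
      case 3
      with n3[of k] show ?thesis by simp
    next
      case 4
      with n4 n3[of "?L + f"] n5[of "?L + f + 2"] add_pipe len L0 show ?thesis by auto
    next
      case 5
      with n5[of k] show ?thesis by simp
    qed
  qed
  have "?ts ! 0 = Medium" using n1[of 0] L0 add_pipe.IH by simp
  moreover have "?ts ! (length ?ts - 1) = Medium"
    using n5[of "length ?ts - 1"] add_pipe len by simp
  ultimately show ?case using * by blast
qed

lemma valid_rows:
  assumes "valid_heat_exchanger S"
  shows "1 \<in> unknown_rows S" "Ny S - 1 \<in> unknown_rows S" "Ny S \<ge> 2" "row_kind S 1 = Medium"
    "\<And>j. 1 \<le> j \<Longrightarrow> j < Ny S \<Longrightarrow> j \<notin> unknown_rows S \<Longrightarrow>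
       j - 1 \<in> unknown_rows S \<and> j + 1 \<in> unknown_rows S"
proof -
  let ?rs = "map (row_kind S) [1..<Ny S]"
  have lay: "pipe_layout (nP S) ?rs" using assms by (simp add: valid_heat_exchanger_def)
  note N = pipe_layout_neighbours[OF lay]
  show two: "Ny S \<ge> 2" using N by auto
  show r1: "row_kind S 1 = Medium" using N two by auto
  show "1 \<in> unknown_rows S" using r1 two by (simp add: unknown_rows_def)
  have "Suc (Ny S - Suc (Suc 0)) = Ny S - 1" using two by linarith
  then have "row_kind S (Ny S - 1) = Medium" using N two by auto
  then show "Ny S - 1 \<in> unknown_rows S" using two by (simp add: unknown_rows_def)
  fix j assume j: "1 \<le> j" "j < Ny S" "j \<notin> unknown_rows S"
  then have ty: "row_kind S j = Lower_Interface \<or> row_kind S j = Upper_Interface"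
    by (cases "row_kind S j") (auto simp: unknown_rows_def)
  define k where "k = j - 1"
  have k: "k < length ?rs" "?rs ! k = row_kind S j" using j by (auto simp: k_def)
  then have s: "0 < k" "k + 1 < length ?rs"
      "?rs ! (k - 1) \<in> {Medium, Fluid}" "?rs ! (k + 1) \<in> {Medium, Fluid}"
    using N ty by (metis insertCI)+
  have "Suc (j - Suc (Suc 0)) = j - 1" using s(1) by (simp add: k_def)
  then have "?rs ! (k - 1) = row_kind S (j - 1)" "?rs ! (k + 1) = row_kind S (j + 1)"
    using s(1,2) by (auto simp: k_def)
  then show "j - 1 \<in> unknown_rows S \<and> j + 1 \<in> unknown_rows S"
    using s by (auto simp: unknown_rows_def k_def)
qed

lemma finite_unknown_rows: "finite (unknown_rows S)"
  by (rule finite_subset[of _ "{..<Ny S}"]) (auto simp: unknown_rows_def)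

lemma q_rows_eq:
  assumes "valid_heat_exchanger S"
  shows "int (q_rows S) = int (Ny S) - 2 * int (nP S) - 1"
proof -
  let ?P = "\<lambda>r. r \<in> {Medium, Fluid}"
  have "unknown_rows S = set (filter (\<lambda>j. ?P (row_kind S j)) [1..<Ny S])"
    by (auto simp: unknown_rows_def)
  then have "q_rows S = length (filter (\<lambda>j. ?P (row_kind S j)) [1..<Ny S])"
    by (simp only: q_rows_def) (rule distinct_card, simp)
  also have "\<dots> = length (filter ?P (map (row_kind S) [1..<Ny S]))"
    by (simp add: filter_map comp_def)
  finally have "q_rows S + 2 * nP S = Ny S - 1"
    using pipe_layout_count[of "nP S" "map (row_kind S) [1..<Ny S]"] assms
    by (simp add: valid_heat_exchanger_def)
  then show ?thesis using valid_rows(3)[OF assms] by linarith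
qed

lemma card_less_sorted_list_nth:
  fixes X :: "nat set"
  assumes "finite X" "k < card X"
  shows "card {y \<in> X. y < sorted_list_of_set X ! k} = k"
proof -
  let ?xs = "sorted_list_of_set X"
  have len: "length ?xs = card X" and st: "sorted_wrt (<) ?xs" and se: "set ?xs = X"
    using assms by auto
  have "{y \<in> X. y < ?xs ! k} = (!) ?xs ` {..<k}"
  proof (intro equalityI subsetI)
    fix y assume y: "y \<in> {y \<in> X. y < ?xs ! k}"
    then obtain a where a: "a < length ?xs" "y = ?xs ! a" using se by (metis in_set_conv_nth mem_Collect_eq)
    have "a < k"
    proof (rule ccontr)
      assume "\<not> a < k"
      then have "?xs ! k \<le> ?xs ! a" using a(1) by (intro sorted_nth_mono) auto
      with y a show False by simp
    qed
    with a show "y \<in> (!) ?xs ` {..<k}" by auto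
  next
    fix y assume "y \<in> (!) ?xs ` {..<k}"
    then obtain a where a: "a < k" "y = ?xs ! a" by auto
    then have "y < ?xs ! k" using st assms len by (simp add: sorted_wrt_iff_nth_less)
    moreover have "y \<in> X" using a assms len se by (metis nth_mem order.strict_trans)
    ultimately show "y \<in> {y \<in> X. y < ?xs ! k}" by simp
  qed
  moreover have "inj_on ((!) ?xs) {..<k}"
    using assms len by (intro inj_on_nth) auto
  ultimately show ?thesis by (simp add: card_image)
qed

lemma node_mem:
  assumes "l < n_unknowns S"
  shows "fst (node S l) \<in> {1..Nx S - 1}" "snd (node S l) \<in> unknown_rows S"
proof -
  have q: "q_rows S > 0" using assms by (auto simp: n_unknowns_def intro: gr0I)
  have "l div q_rows S < Nx S - 1"
    using assms by (simp add: n_unknowns_def less_mult_imp_div_less)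
  then show "fst (node S l) \<in> {1..Nx S - 1}" by (simp add: node_def)
  have "l mod q_rows S < length (sorted_list_of_set (unknown_rows S))"
    using q by (simp add: q_rows_def)
  then show "snd (node S l) \<in> unknown_rows S"
    using finite_unknown_rows by (metis node_def nth_mem set_sorted_list_of_set snd_conv)
qed

lemma Kidx_node:
  assumes "l < n_unknowns S"
  shows "Kidx S (fst (node S l)) (snd (node S l)) = l"
proof -
  have "q_rows S > 0" using assms by (auto simp: n_unknowns_def intro: gr0I)
  then have "l mod q_rows S < card (unknown_rows S)" by (simp add: q_rows_def)
  from card_less_sorted_list_nth[OF finite_unknown_rows this]
  show ?thesis by (simp add: Kidx_def node_def)
qed

lemma node_Kidx:
  assumes "i \<in> {1..Nx S - 1}" "j \<in> unknown_rows S"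
  shows "Kidx S i j < n_unknowns S" "node S (Kidx S i j) = (i, j)"
proof -
  let ?xs = "sorted_list_of_set (unknown_rows S)"
  obtain k where k: "k < length ?xs" "?xs ! k = j"
    using assms(2) finite_unknown_rows by (metis in_set_conv_nth set_sorted_list_of_set)
  then have kq: "k < q_rows S" by (simp add: q_rows_def)
  have K: "Kidx S i j = (i - 1) * q_rows S + k"
    using card_less_sorted_list_nth[OF finite_unknown_rows, of k S] k by (simp add: Kidx_def)
  have "Kidx S i j < (i - 1) * q_rows S + q_rows S" using K kq by simp
  also have "\<dots> = i * q_rows S" using assms(1) by (cases i) auto
  also have "\<dots> \<le> n_unknowns S" using assms(1) by (simp add: n_unknowns_def)
  finally show "Kidx S i j < n_unknowns S" .
  show "node S (Kidx S i j) = (i, j)"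
    using K kq k assms(1) by (auto simp: node_def)
qed

lemma grid_value_linear:
  assumes S: "valid_heat_exchanger S" and Y: "Y \<in> carrier_vec (n_unknowns S)"
    and ij: "i \<in> {1..Nx S - 1} \<and> j \<le> Ny S \<or> i \<le> Nx S \<and> j \<in> unknown_rows S"
  shows "grid_value S v QI QG (\<lambda>i j. Y $ Kidx S i j) i j =
    (\<Sum>m = 0..<n_unknowns S.
        grid_value S v 0 0 (\<lambda>i j. unit_vec (n_unknowns S) m $ Kidx S i j) i j * Y $ m) +
    (if i = 0 \<and> row_kind S j = Fluid \<and> v = v_bar S then QI else 0) +
    (if j = 0 then lambda_G S * hy S / (kappa_M S + lambda_G S * hy S) * QG else 0)"
proof -
  let ?n = "n_unknowns S"
  have unit: "(\<Sum>m = 0..<?n. unit_vec ?n m $ Kidx S a b * Y $ m) = Y $ Kidx S a b"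
    if "a \<in> {1..Nx S - 1}" "b \<in> unknown_rows S" for a b
  proof -
    have "Kidx S a b < ?n" using node_Kidx(1)[OF that] .
    then show ?thesis by (simp add: unit_vec_def if_distrib[where f = "\<lambda>x. x * _"] cong: if_cong)
  qed
  have scal: "(\<Sum>m = 0..<?n. c * unit_vec ?n m $ Kidx S a b * Y $ m) = c * Y $ Kidx S a b"
    if "a \<in> {1..Nx S - 1}" "b \<in> unknown_rows S" for a b c
    using unit[OF that] by (simp add: mult.assoc flip: sum_distrib_left)
  have scal2: "(\<Sum>m = 0..<?n. (c * unit_vec ?n m $ Kidx S a b + c' * unit_vec ?n m $ Kidx S a b') * Y $ m)
      = c * Y $ Kidx S a b + c' * Y $ Kidx S a b'"
    if "a \<in> {1..Nx S - 1}" "b \<in> unknown_rows S" "b' \<in> unknown_rows S" for a b b' c c'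
    using scal[of a b c] scal[of a b' c'] that by (simp add: distrib_right sum.distrib)
  have Nx: "Nx S \<ge> 3" using S by (simp add: valid_heat_exchanger_def)
  note V = valid_rows[OF S]
  have J: "j \<noteq> 0 \<and> j < Ny S" if "j \<in> unknown_rows S" using that by (auto simp: unknown_rows_def)
  consider "j = Ny S" | "j = 0" | "0 < j" "j < Ny S" "i = Nx S" | "0 < j" "j < Ny S" "i = 0"
    | "0 < j" "j < Ny S" "i \<in> {1..Nx S - 1}"
    using ij J Nx by fastforce
  then show ?thesis
  proof cases
    case 1
    then have "i \<in> {1..Nx S - 1}" using ij J by auto
    with 1 V(2,3) show ?thesis by (simp add: grid_value_def unit)
  next
    case 2
    then have "i \<in> {1..Nx S - 1}" using ij J by auto
    with scal[of i 1 "kappa_M S / (kappa_M S + lambda_G S * hy S)"] 2 V(1,3)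
    show ?thesis by (simp add: grid_value_def)
  next
    case 3
    then have "j \<in> unknown_rows S" using ij Nx by auto
    with 3 Nx show ?thesis by (simp add: grid_value_def unit)
  next
    case 4
    then have "j \<in> unknown_rows S" using ij by auto
    with 4 Nx unit[of 1 j] show ?thesis
      by (cases "row_kind S j = Fluid \<and> v = v_bar S") (auto simp: grid_value_def)
  next
    case 5
    have nn: "i \<noteq> Nx S" "i \<noteq> 0" using 5 by auto
    show ?thesis
    proof (cases "j \<in> unknown_rows S")
      case True
      then have "row_kind S j = Medium \<or> row_kind S j = Fluid" by (auto simp: unknown_rows_def)
      then show ?thesis using 5 nn unit[OF 5(3) True] by (auto simp: grid_value_def)
    next
      case False
      then have "j - 1 \<in> unknown_rows S" "j + 1 \<in> unknown_rows S" using V(5) 5 by auto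
      moreover have "row_kind S j = Lower_Interface \<or> row_kind S j = Upper_Interface"
        using False 5 by (cases "row_kind S j") (auto simp: unknown_rows_def)
      ultimately show ?thesis using 5 nn
          scal2[OF 5(3), of "j - 1" "j + 1"] scal2[OF 5(3), of "j + 1" "j - 1"]
        by (auto simp: grid_value_def)
    qed
  qed
qed

theorem rhs_eq_matrix_form:
  assumes S: "valid_heat_exchanger S" and Y: "Y \<in> carrier_vec (n_unknowns S)"
    and l: "l < n_unknowns S"
  shows "rhs S v QI QG (\<lambda>i j. Y $ Kidx S i j) (node S l) =
    (A_mat S v *\<^sub>v Y + B_mat S v *\<^sub>v g_vec S v QI QG) $ l"
proof -
  let ?n = "n_unknowns S"
  define i j where "i = fst (node S l)" and "j = snd (node S l)"
  have nd: "node S l = (i, j)" by (simp add: i_def j_def)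
  have i: "i \<in> {1..Nx S - 1}" and j: "j \<in> unknown_rows S"
    using node_mem[OF l] by (auto simp: i_def j_def)
  have Kl: "Kidx S i j = l" using Kidx_node[OF l] by (simp add: i_def j_def)
  have j': "1 \<le> j" "j < Ny S" using j by (auto simp: unknown_rows_def)
  let ?U = "\<lambda>m i j. unit_vec ?n m $ Kidx S i j"
  let ?c = "lambda_G S * hy S / (kappa_M S + lambda_G S * hy S)"
  have fl: "(\<exists>j'\<in>unknown_rows S. row_kind S j' = Fluid \<and> l = Kidx S 1 j') \<longleftrightarrow> i = 1 \<and> row_kind S j = Fluid"
  proof
    assume "\<exists>j'\<in>unknown_rows S. row_kind S j' = Fluid \<and> l = Kidx S 1 j'"
    then obtain j' where "j' \<in> unknown_rows S" "row_kind S j' = Fluid" "l = Kidx S 1 j'" by blast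
    moreover have "1 \<in> {1..Nx S - 1}" using i by auto
    ultimately show "i = 1 \<and> row_kind S j = Fluid" using node_Kidx(2) nd by (metis Pair_inject)
  qed (use Kl j in auto)
  have bo: "(\<exists>i'\<in>{1..Nx S - 1}. l = Kidx S i' 1) \<longleftrightarrow> j = 1"
  proof
    assume "\<exists>i'\<in>{1..Nx S - 1}. l = Kidx S i' 1"
    then show "j = 1" using node_Kidx(2) valid_rows(1)[OF S] nd by (metis Pair_inject)
  qed (use Kl i in auto)
  have g: "dim_vec (g_vec S v QI QG) = 2"
      "g_vec S v QI QG $ 0 = (if v = v_bar S then QI else 0)" "g_vec S v QI QG $ 1 = QG"
    by (simp_all add: g_vec_def)
  have B: "(B_mat S v *\<^sub>v g_vec S v QI QG) $ l =
      (if v = v_bar S \<and> i = 1 \<and> row_kind S j = Fluid then (a_F S / (hx S)\<^sup>2 + v_bar S / hx S) * QI else 0) +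
      (if j = 1 then ?c * (a_M S / (hy S)\<^sup>2) * QG else 0)"
    using l g fl bo
    by (simp add: B_mat_def scalar_prod_def numeral_2_eq_2)
  have A: "(A_mat S v *\<^sub>v Y) $ l = (\<Sum>m = 0..<?n. rhs S v 0 0 (?U m) (i, j) * Y $ m)"
    using l Y nd by (simp add: A_mat_def scalar_prod_def)
  have rm: "row_kind S j = Medium \<or> row_kind S j = Fluid" using j by (auto simp: unknown_rows_def)
  have cen: "Y $ Kidx S i j = (\<Sum>m = 0..<?n. ?U m i j * Y $ m)"
    using l Kl by (simp add: unit_vec_def if_distrib[where f = "\<lambda>x. x * _"] cong: if_cong)
  note L = grid_value_linear[OF S Y]
  have n1: "grid_value S v QI QG (\<lambda>i j. Y $ Kidx S i j) (i + 1) j =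
      (\<Sum>m = 0..<?n. grid_value S v 0 0 (?U m) (i + 1) j * Y $ m)"
  proof -
    have "i + 1 \<le> Nx S" using i by auto
    then show ?thesis using L[of "i + 1" j v QI QG] j j' by auto
  qed
  have n2: "grid_value S v QI QG (\<lambda>i j. Y $ Kidx S i j) (i - 1) j =
      (\<Sum>m = 0..<?n. grid_value S v 0 0 (?U m) (i - 1) j * Y $ m) +
      (if i = 1 \<and> row_kind S j = Fluid \<and> v = v_bar S then QI else 0)"
  proof -
    have "i - 1 \<le> Nx S" "i - 1 = 0 \<longleftrightarrow> i = 1" using i by auto
    then show ?thesis using L[of "i - 1" j v QI QG] j j' by simp
  qed
  have n3: "grid_value S v QI QG (\<lambda>i j. Y $ Kidx S i j) i (j + 1) =
      (\<Sum>m = 0..<?n. grid_value S v 0 0 (?U m) i (j + 1) * Y $ m)"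
    using L[of i "j + 1" v QI QG] i j j' by auto
  have n4: "grid_value S v QI QG (\<lambda>i j. Y $ Kidx S i j) i (j - 1) =
      (\<Sum>m = 0..<?n. grid_value S v 0 0 (?U m) i (j - 1) * Y $ m) +
      (if j = 1 then ?c * QG else 0)"
  proof -
    have "j - 1 \<le> Ny S" "j - 1 = 0 \<longleftrightarrow> j = 1" "i \<noteq> 0" using i j' by auto
    then show ?thesis using L[of i "j - 1" v QI QG] i by simp
  qed
  have "rhs S v QI QG (\<lambda>i j. Y $ Kidx S i j) (i, j) =
      (\<Sum>m = 0..<?n. rhs S v 0 0 (?U m) (i, j) * Y $ m) +
      alpha_minus S v j * (if i = 1 \<and> row_kind S j = Fluid \<and> v = v_bar S then QI else 0) +
      beta S j * (if j = 1 then ?c * QG else 0)"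
    unfolding rhs_def prod.case n1 n2 n3 n4 cen
    by (simp add: algebra_simps sum.distrib sum_distrib_left)
  also have "alpha_minus S v j * (if i = 1 \<and> row_kind S j = Fluid \<and> v = v_bar S then QI else 0) =
      (if v = v_bar S \<and> i = 1 \<and> row_kind S j = Fluid then (a_F S / (hx S)\<^sup>2 + v_bar S / hx S) * QI else 0)"
    by (simp add: alpha_minus_def diffusivity_def)
  also have "beta S j * (if j = 1 then ?c * QG else 0) =
      (if j = 1 then ?c * (a_M S / (hy S)\<^sup>2) * QG else 0)"
    using valid_rows(4)[OF S] by (simp add: beta_def diffusivity_def)
  finally show ?thesis
    using A B l nd by (simp add: A_mat_def B_mat_def)
qed

end

theory Submission
  imports Defs
begin

text \<open>
  The scheme obeys a discrete maximum principle. In every difference equation the coefficients of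
  the four neighbours are nonnegative, because the convection term is discretized upwind, and they
  add up to the modulus \<open>d = - gamma S v j\<close> of the central coefficient. Eliminating boundary and
  interface values does not spoil this: with zero inlet and ground data each eliminated value is a
  subconvex combination of unknowns, hence bounded by the maximum norm of the unknowns. So for each
  row \<open>l\<close> of \<open>A\<close> there is \<open>d \<in> [0, \<eta>]\<close> with
  \<open>\<bar>(A Y)\<^sub>l + d Y\<^sub>l\<bar> \<le> d \<parallel>Y\<parallel>\<close> (\<open>A_mat_row_dominance\<close>).
  This is all that is used about \<open>A\<close>. It is proved on the grid equations, where no case
  distinction over matrix entries arises.

  Two estimates follow. An explicit step \<open>Y + s A Y\<close> does not increase the norm as long as
  \<open>s \<eta> \<le> 1\<close>, for then each new entry is an average of old values
  (\<open>explicit_half_step\<close>). The norm of \<open>Y\<close> never exceeds that of \<open>Y - s A Y\<close>, for any \<open>s \<ge> 0\<close>: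
  at an entry where \<open>\<bar>Y\<^sub>l\<bar>\<close> is maximal the neighbours cannot outweigh the centre
  (\<open>implicit_half_step\<close>). Thus \<open>G\<^sup>-\<^sup>1\<close> has norm at most 1 without any step size restriction, and
  \<open>H\<close> has norm at most 1 under the one of the theorem, which is void for \<open>\<theta> = 1\<close>. Every time step
  then adds at most \<open>\<tau> C\<^sub>B\<close> times the size of the data (\<open>theta_scheme_one_step\<close>), and \<open>k\<close> steps add
  at most \<open>k \<tau> C\<^sub>B \<le> T C\<^sub>B\<close> times it.
\<close>

section \<open>The maximum norm of vectors and matrices\<close>

lemma abs_index_le_vec_norm_inf:
  "i < dim_vec x \<Longrightarrow> \<bar>x $ i\<bar> \<le> vec_norm_inf x"
  by (auto simp: vec_norm_inf_def intro!: Max_ge)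

lemma vec_norm_inf_leI:
  assumes "dim_vec x > 0" and "\<And>i. i < dim_vec x \<Longrightarrow> \<bar>x $ i\<bar> \<le> c"
  shows "vec_norm_inf x \<le> c"
  using assms by (auto simp: vec_norm_inf_def)

lemma vec_norm_inf_attained:
  assumes "dim_vec x > 0"
  obtains i where "i < dim_vec x" "\<bar>x $ i\<bar> = vec_norm_inf x"
proof -
  have "vec_norm_inf x \<in> (\<lambda>i. \<bar>x $ i\<bar>) ` {0..<dim_vec x}"
    unfolding vec_norm_inf_def using assms by (intro Max_in) auto
  then show ?thesis using that by auto
qed

lemma vec_norm_inf_nonneg: "dim_vec x > 0 \<Longrightarrow> 0 \<le> vec_norm_inf x"
  using abs_index_le_vec_norm_inf[of 0 x] by linarith

lemma row_sum_le_mat_norm_inf: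
  "i < dim_row M \<Longrightarrow> (\<Sum>j = 0..<dim_col M. \<bar>M $$ (i, j)\<bar>) \<le> mat_norm_inf M"
  by (auto simp: mat_norm_inf_def intro!: Max_ge)

lemma abs_index_le_mat_norm_inf:
  assumes "i < dim_row M" "j < dim_col M"
  shows "\<bar>M $$ (i, j)\<bar> \<le> mat_norm_inf M"
proof -
  have "\<bar>M $$ (i, j)\<bar> \<le> (\<Sum>j = 0..<dim_col M. \<bar>M $$ (i, j)\<bar>)"
    using assms by (intro member_le_sum) auto
  with row_sum_le_mat_norm_inf[OF assms(1)] show ?thesis by linarith
qed

lemma abs_mult_mat_vec_le:
  assumes "i < dim_row M" "dim_vec x = dim_col M" "dim_vec x > 0"
  shows "\<bar>(M *\<^sub>v x) $ i\<bar> \<le> mat_norm_inf M * vec_norm_inf x"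
proof -
  have "(M *\<^sub>v x) $ i = (\<Sum>j = 0..<dim_col M. M $$ (i, j) * x $ j)"
    using assms by (simp add: scalar_prod_def)
  also have "\<bar>\<dots>\<bar> \<le> (\<Sum>j = 0..<dim_col M. \<bar>M $$ (i, j)\<bar> * vec_norm_inf x)"
    using assms abs_index_le_vec_norm_inf[of _ x]
    by (intro order_trans[OF sum_abs] sum_mono) (auto simp: abs_mult intro!: mult_left_mono)
  also have "\<dots> = (\<Sum>j = 0..<dim_col M. \<bar>M $$ (i, j)\<bar>) * vec_norm_inf x"
    by (simp add: sum_distrib_right)
  also have "\<dots> \<le> mat_norm_inf M * vec_norm_inf x"
    using row_sum_le_mat_norm_inf[OF assms(1)] vec_norm_inf_nonneg[OF assms(3)]
    by (rule mult_right_mono)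
  finally show ?thesis .
qed

section \<open>Signs of the coefficients\<close>

lemma coefficient_positivity:
  assumes "valid_heat_exchanger S"
  shows "hx S > 0" "hy S > 0" "a_M S > 0" "a_F S > 0" "v_bar S > 0"
  using assms valid_rows(3)[OF assms]
  by (auto simp: valid_heat_exchanger_def hx_def hy_def a_M_def a_F_def)

lemma psi_weights:
  assumes "valid_heat_exchanger S"
  shows "0 \<le> psi_F S" "0 \<le> psi_M S" "psi_F S + psi_M S = 1"
  using assms by (auto simp: valid_heat_exchanger_def psi_F_def psi_M_def)

lemma ground_weight:
  assumes "valid_heat_exchanger S"
  shows "0 \<le> kappa_M S / (kappa_M S + lambda_G S * hy S)"
    "kappa_M S / (kappa_M S + lambda_G S * hy S) \<le> 1"
    "0 < lambda_G S * hy S / (kappa_M S + lambda_G S * hy S)"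
proof -
  have "kappa_M S > 0" "lambda_G S * hy S > 0"
    using assms coefficient_positivity[OF assms] by (auto simp: valid_heat_exchanger_def)
  then show "0 \<le> kappa_M S / (kappa_M S + lambda_G S * hy S)"
    "kappa_M S / (kappa_M S + lambda_G S * hy S) \<le> 1"
    "0 < lambda_G S * hy S / (kappa_M S + lambda_G S * hy S)"
    by auto
qed

lemma diffusivity_bounds:
  assumes "valid_heat_exchanger S"
  shows "0 < diffusivity S j" "diffusivity S j \<le> max (a_F S) (a_M S)"
  using coefficient_positivity[OF assms] by (auto simp: diffusivity_def)

text \<open>The neighbour weights are nonnegative, since upwinding lets the velocity \<open>v \<ge> 0\<close>
  enter them only through a nonnegative term in \<open>alpha_minus\<close>, and they balance the central coefficient, since the stencil annihilates
  constants. The quantity \<open>eta\<close> bounds the central coefficient uniformly over the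
  rows and over both pump states.\<close>

lemma stencil_coefficients:
  assumes S: "valid_heat_exchanger S" and v: "0 \<le> v" "v \<le> v_bar S"
  shows "0 \<le> alpha_plus S j" "0 \<le> alpha_minus S v j" "0 \<le> beta S j"
    "alpha_plus S j + alpha_minus S v j + 2 * beta S j = - gamma S v j"
    "- gamma S v j \<le> eta S"
proof -
  note P = coefficient_positivity[OF S] and D = diffusivity_bounds[OF S, of j]
  show "0 \<le> alpha_plus S j" "0 \<le> alpha_minus S v j" "0 \<le> beta S j"
    using P D v by (auto simp: alpha_plus_def alpha_minus_def beta_def)
  show "alpha_plus S j + alpha_minus S v j + 2 * beta S j = - gamma S v j"
    by (simp add: alpha_plus_def alpha_minus_def beta_def gamma_def algebra_simps)
  have "diffusivity S j * (1 / (hx S)\<^sup>2 + 1 / (hy S)\<^sup>2)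
      \<le> max (a_F S) (a_M S) * (1 / (hx S)\<^sup>2 + 1 / (hy S)\<^sup>2)"
    using D by (intro mult_right_mono) auto
  moreover have "(if row_kind S j = Fluid then v / hx S else 0) \<le> v_bar S / hx S"
    using P v by (auto simp: divide_right_mono)
  ultimately show "- gamma S v j \<le> eta S"
    by (simp add: gamma_def eta_def)
qed

lemma eta_pos:
  assumes "valid_heat_exchanger S"
  shows "0 < eta S"
proof -
  note P = coefficient_positivity[OF assms]
  have "0 \<le> 2 * max (a_F S) (a_M S) * (1 / (hx S)\<^sup>2 + 1 / (hy S)\<^sup>2)"
    using P by (intro mult_nonneg_nonneg) auto
  moreover have "0 < v_bar S / hx S" using P by simp
  ultimately show ?thesis by (simp add: eta_def)
qed

lemma n_unknowns_pos:
  assumes "valid_heat_exchanger S"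
  shows "0 < n_unknowns S"
proof -
  have "1 \<in> {1..Nx S - 1}" using assms by (auto simp: valid_heat_exchanger_def)
  from node_Kidx(1)[OF this valid_rows(1)[OF assms]] show ?thesis by simp
qed

section \<open>The discrete maximum principle\<close>

lemma abs_convex_combination_le:
  fixes a b x y M :: real
  assumes "0 \<le> a" "0 \<le> b" "a + b = 1" "\<bar>x\<bar> \<le> M" "\<bar>y\<bar> \<le> M"
  shows "\<bar>a * x + b * y\<bar> \<le> M"
proof -
  have "\<bar>a * x + b * y\<bar> \<le> a * \<bar>x\<bar> + b * \<bar>y\<bar>"
    using assms(1,2) abs_triangle_ineq[of "a * x" "b * y"] by (simp add: abs_mult)
  also have "\<dots> \<le> M" using assms by (intro convex_bound_le) auto
  finally show ?thesis .
qed

text \<open>Zero inlet and ground data are essential here. Insulated boundaries and an inlet with the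
  pump off copy an unknown, an inlet with the pump on gives zero, the Robin condition at the bottom
  damps an unknown by a factor in \<open>[0, 1]\<close>, and an interface value averages the two adjacent rows,
  which are never interface rows themselves.\<close>

lemma abs_grid_value_le:
  assumes S: "valid_heat_exchanger S"
    and Q: "\<And>i j. i \<in> {1..Nx S - 1} \<Longrightarrow> j \<in> unknown_rows S \<Longrightarrow> \<bar>Q i j\<bar> \<le> M"
    and ij: "i \<in> {1..Nx S - 1} \<and> j \<le> Ny S \<or> i \<le> Nx S \<and> j \<in> unknown_rows S"
  shows "\<bar>grid_value S v 0 0 Q i j\<bar> \<le> M"
proof -
  note V = valid_rows[OF S]
  have Nx: "Nx S \<ge> 3" using S by (simp add: valid_heat_exchanger_def)
  have J: "j \<noteq> 0 \<and> j < Ny S" if "j \<in> unknown_rows S" using that by (auto simp: unknown_rows_def)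
  have "\<bar>Q 1 1\<bar> \<le> M" using Q[of 1 1] V(1) Nx by simp
  then have M: "0 \<le> M" by linarith
  consider "j = Ny S" | "j = 0" | "0 < j" "j < Ny S" "i = Nx S" | "0 < j" "j < Ny S" "i = 0"
    | "0 < j" "j < Ny S" "i \<in> {1..Nx S - 1}"
    using ij J Nx by fastforce
  then show ?thesis
  proof cases
    case 1
    then have "i \<in> {1..Nx S - 1}" using ij J by auto
    with 1 Q[of i "Ny S - 1"] V(2) show ?thesis by (simp add: grid_value_def)
  next
    case 2
    then have "i \<in> {1..Nx S - 1}" using ij J by auto
    then have q: "\<bar>Q i 1\<bar> \<le> M" using Q V(1) by simp
    define c where "c = kappa_M S / (kappa_M S + lambda_G S * hy S)"
    have "0 \<le> c" "c \<le> 1" using ground_weight(1,2)[OF S] by (auto simp: c_def)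
    then have "\<bar>c * Q i 1\<bar> \<le> 1 * M"
      unfolding abs_mult using q by (intro mult_mono) auto
    with 2 V(3) show ?thesis by (simp add: grid_value_def c_def)
  next
    case 3
    then have "j \<in> unknown_rows S" using ij Nx by auto
    with 3 Nx Q[of "Nx S - 1" j] show ?thesis by (simp add: grid_value_def)
  next
    case 4
    then have "j \<in> unknown_rows S" using ij by auto
    with 4 Nx M Q[of 1 j] show ?thesis by (simp add: grid_value_def)
  next
    case 5
    have nn: "i \<noteq> Nx S" "i \<noteq> 0" using 5 by auto
    show ?thesis
    proof (cases "j \<in> unknown_rows S")
      case True
      then have "row_kind S j = Medium \<or> row_kind S j = Fluid" by (auto simp: unknown_rows_def)
      then show ?thesis using 5 nn Q[OF 5(3) True] by (auto simp: grid_value_def)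
    next
      case False
      then have n: "\<bar>Q i (j - 1)\<bar> \<le> M" "\<bar>Q i (j + 1)\<bar> \<le> M" using V(5) 5 Q by auto
      have "row_kind S j = Lower_Interface \<or> row_kind S j = Upper_Interface"
        using False 5 by (cases "row_kind S j") (auto simp: unknown_rows_def)
      then show ?thesis using 5 nn
          abs_convex_combination_le[OF psi_weights[OF S] n]
          abs_convex_combination_le[OF psi_weights[OF S] n(2,1)]
        by (auto simp: grid_value_def)
    qed
  qed
qed

text \<open>Turns a row of \<open>A\<close> back into the difference equation it was read off from, so that matrix
  estimates reduce to estimates of grid values.\<close>

lemma A_mat_mult_eq_rhs:
  assumes "valid_heat_exchanger S" "Y \<in> carrier_vec (n_unknowns S)" "l < n_unknowns S"
  shows "(A_mat S v *\<^sub>v Y) $ l = rhs S v 0 0 (\<lambda>i j. Y $ Kidx S i j) (node S l)"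
proof -
  have "(B_mat S v *\<^sub>v g_vec S v 0 0) $ l = 0"
    using assms(3) by (simp add: B_mat_def g_vec_def scalar_prod_def numeral_2_eq_2)
  then show ?thesis
    using rhs_eq_matrix_form[OF assms, of v 0 0] assms(3) by (simp add: B_mat_def)
qed

text \<open>Weak diagonal dominance of \<open>A\<close> with diagonal \<open>- d\<close> and nonnegative remaining weights. The number
  \<open>d\<close> is the central coefficient of the stencil and need not be the diagonal entry of the matrix,
  because eliminated neighbours may feed back into the central unknown. The inequality
  holds all the same: \<open>d\<close> is the total weight of the four neighbours, whose values are all
  bounded by \<open>vec_norm_inf Y\<close>.\<close>

lemma A_mat_row_dominance:
  assumes S: "valid_heat_exchanger S" and v: "0 \<le> v" "v \<le> v_bar S"
    and Y: "Y \<in> carrier_vec (n_unknowns S)" and l: "l < n_unknowns S"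
  obtains d where "0 \<le> d" "d \<le> eta S"
    "\<bar>(A_mat S v *\<^sub>v Y) $ l + d * Y $ l\<bar> \<le> d * vec_norm_inf Y"
proof -
  obtain i j where nd: "node S l = (i, j)" by fastforce
  have i: "i \<in> {1..Nx S - 1}" and j: "j \<in> unknown_rows S"
    using node_mem[OF l] nd by auto
  then have ij: "i \<le> Nx S" "i + 1 \<le> Nx S" "i - 1 \<le> Nx S" "j + 1 \<le> Ny S" "j - 1 \<le> Ny S"
    by (auto simp: unknown_rows_def)
  have Kl: "Kidx S i j = l" using Kidx_node[OF l] nd by simp
  let ?M = "vec_norm_inf Y" and ?g = "grid_value S v 0 0 (\<lambda>i j. Y $ Kidx S i j)"
  have Q: "\<bar>Y $ Kidx S a b\<bar> \<le> ?M" if "a \<in> {1..Nx S - 1}" "b \<in> unknown_rows S" for a b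
    using node_Kidx(1)[OF that] Y by (intro abs_index_le_vec_norm_inf) auto
  note G = abs_grid_value_le[OF S, of "\<lambda>i j. Y $ Kidx S i j", OF Q]
  note C = stencil_coefficients[OF S v, of j]
  have t: "\<bar>c * x\<bar> \<le> c * ?M" if "0 \<le> c" "\<bar>x\<bar> \<le> ?M" for c x
    using that by (simp add: abs_mult mult_left_mono)
  have "(A_mat S v *\<^sub>v Y) $ l + (- gamma S v j) * Y $ l =
      alpha_plus S j * ?g (i + 1) j + alpha_minus S v j * ?g (i - 1) j +
      beta S j * ?g i (j + 1) + beta S j * ?g i (j - 1)"
    unfolding A_mat_mult_eq_rhs[OF S Y l] by (simp add: rhs_def nd Kl)
  also have "\<bar>\<dots>\<bar> \<le> alpha_plus S j * ?M + alpha_minus S v j * ?M + beta S j * ?M + beta S j * ?M"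
    using i j ij
    by (intro order_trans[OF abs_triangle_ineq] add_mono t C G) auto
  also have "\<dots> = (alpha_plus S j + alpha_minus S v j + 2 * beta S j) * ?M"
    by (simp add: algebra_simps)
  finally have "\<bar>(A_mat S v *\<^sub>v Y) $ l + (- gamma S v j) * Y $ l\<bar> \<le> (- gamma S v j) * ?M"
    unfolding C(4) .
  moreover have "0 \<le> - gamma S v j" using C(1-4) by linarith
  ultimately show ?thesis using that C(5) by blast
qed

text \<open>The step size condition keeps \<open>1 - s d\<close> nonnegative, so in
  \<open>Y\<^sub>l + s (A Y)\<^sub>l = (1 - s d) Y\<^sub>l + s ((A Y)\<^sub>l + d Y\<^sub>l)\<close> the two summands are bounded by
  \<open>(1 - s d) \<parallel>Y\<parallel>\<close> and \<open>s d \<parallel>Y\<parallel>\<close>.\<close>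

lemma explicit_half_step:
  assumes S: "valid_heat_exchanger S" and v: "0 \<le> v" "v \<le> v_bar S"
    and Y: "Y \<in> carrier_vec (n_unknowns S)" and l: "l < n_unknowns S"
    and s: "0 \<le> s" "s * eta S \<le> 1"
  shows "\<bar>Y $ l + s * (A_mat S v *\<^sub>v Y) $ l\<bar> \<le> vec_norm_inf Y"
proof -
  let ?M = "vec_norm_inf Y" and ?a = "(A_mat S v *\<^sub>v Y) $ l"
  obtain d where d: "0 \<le> d" "d \<le> eta S" "\<bar>?a + d * Y $ l\<bar> \<le> d * ?M"
    using A_mat_row_dominance[OF S v Y l] .
  have sd: "0 \<le> 1 - s * d" using mult_left_mono[OF d(2) s(1)] s(2) by linarith
  have "Y $ l + s * ?a = (1 - s * d) * Y $ l + s * (?a + d * Y $ l)"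
    by (simp add: algebra_simps)
  also have "\<bar>\<dots>\<bar> \<le> (1 - s * d) * \<bar>Y $ l\<bar> + s * \<bar>?a + d * Y $ l\<bar>"
    using abs_triangle_ineq[of "(1 - s * d) * Y $ l" "s * (?a + d * Y $ l)"] sd s(1)
    by (simp add: abs_mult)
  also have "\<dots> \<le> (1 - s * d) * ?M + s * (d * ?M)"
    using d sd s Y l abs_index_le_vec_norm_inf[of l Y] by (intro add_mono mult_left_mono) auto
  also have "\<dots> = ?M" by (simp add: algebra_simps)
  finally show ?thesis .
qed

text \<open>Look at an entry \<open>l\<close> with \<open>\<bar>Y\<^sub>l\<bar> = \<parallel>Y\<parallel>\<close>. There \<open>(1 + s d) \<parallel>Y\<parallel>\<close> is at most \<open>c\<close> plus the contribution
  \<open>s d \<parallel>Y\<parallel>\<close> of the neighbours, and the terms with \<open>s d\<close> cancel, whatever the size of \<open>s\<close>.\<close>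

lemma implicit_half_step:
  assumes S: "valid_heat_exchanger S" and v: "0 \<le> v" "v \<le> v_bar S"
    and Y: "Y \<in> carrier_vec (n_unknowns S)" and s: "0 \<le> s"
    and le: "\<And>l. l < n_unknowns S \<Longrightarrow> \<bar>Y $ l - s * (A_mat S v *\<^sub>v Y) $ l\<bar> \<le> c"
  shows "vec_norm_inf Y \<le> c"
proof -
  let ?M = "vec_norm_inf Y"
  obtain l where l: "l < n_unknowns S" and max: "\<bar>Y $ l\<bar> = ?M"
    using vec_norm_inf_attained[of Y] Y n_unknowns_pos[OF S] by auto
  let ?a = "(A_mat S v *\<^sub>v Y) $ l"
  obtain d where d: "0 \<le> d" "\<bar>?a + d * Y $ l\<bar> \<le> d * ?M"
    using A_mat_row_dominance[OF S v Y l] by blast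
  have sd: "0 \<le> 1 + s * d" using s d(1) by simp
  have "(1 + s * d) * ?M = \<bar>(1 + s * d) * Y $ l\<bar>"
    using sd max by (simp add: abs_mult)
  also have "(1 + s * d) * Y $ l = (Y $ l - s * ?a) + s * (?a + d * Y $ l)"
    by (simp add: algebra_simps)
  also have "\<bar>\<dots>\<bar> \<le> \<bar>Y $ l - s * ?a\<bar> + s * \<bar>?a + d * Y $ l\<bar>"
    using abs_triangle_ineq[of "Y $ l - s * ?a" "s * (?a + d * Y $ l)"] s
    by (simp add: abs_mult)
  also have "\<dots> \<le> c + s * (d * ?M)"
    using le[OF l] d(2) s by (intro add_mono mult_left_mono) auto
  finally show ?thesis by (simp add: algebra_simps)
qed

section \<open>Stability of the scheme\<close>

text \<open>The definition of stability demands a positive constant in front of the data. The ground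
  always acts on the lowest row, so \<open>B\<close> has a positive entry in that row even when the pump is off.\<close>

lemma C_B_pos:
  assumes S: "valid_heat_exchanger S"
  shows "0 < C_B S"
proof -
  note P = coefficient_positivity[OF S]
  have one: "1 \<in> {1..Nx S - 1}" using S by (auto simp: valid_heat_exchanger_def)
  have K: "Kidx S 1 1 < n_unknowns S" using node_Kidx(1)[OF one valid_rows(1)[OF S]] .
  have "B_mat S 0 $$ (Kidx S 1 1, 1) =
      lambda_G S * hy S / (kappa_M S + lambda_G S * hy S) * (a_M S / (hy S)\<^sup>2)"
    using K one by (auto simp: B_mat_def)
  also have "\<dots> > 0" using ground_weight(3)[OF S] P by (intro mult_pos_pos) auto
  finally have "0 < \<bar>B_mat S 0 $$ (Kidx S 1 1, 1)\<bar>" by simp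
  also have "\<dots> \<le> mat_norm_inf (B_mat S 0)"
    using K by (intro abs_index_le_mat_norm_inf) (auto simp: B_mat_def)
  also have "\<dots> \<le> C_B S" by (simp add: C_B_def)
  finally show ?thesis .
qed

lemma velocity_on_time_grid:
  assumes S: "valid_heat_exchanger S" and N: "N \<ge> 1" and k: "k \<le> N"
  shows "v0 S (time S N k) \<in> {0, v_bar S}"
proof -
  have T: "0 < horizon S" using S by (simp add: valid_heat_exchanger_def)
  have "time S N k = (real k / real N) * horizon S" by (simp add: time_def tau_def)
  moreover have "(real k / real N) * horizon S \<le> 1 * horizon S"
    using T N k by (intro mult_right_mono) auto
  ultimately have "time S N k \<in> {0..horizon S}" using T by simp
  then show ?thesis using S by (auto simp: valid_heat_exchanger_def)
qed

lemma abs_source_le: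
  assumes S: "valid_heat_exchanger S" and N: "N \<ge> 1" and k: "k \<le> N" and l: "l < n_unknowns S"
  shows "\<bar>(B_step S N k *\<^sub>v g_step S N QI QG k) $ l\<bar> \<le> C_B S * vec_norm_inf (g_step S N QI QG k)"
proof -
  let ?B = "B_step S N k" and ?g = "g_step S N QI QG k"
  have g: "dim_vec ?g = 2" by (simp add: g_step_def g_vec_def)
  have "\<bar>(?B *\<^sub>v ?g) $ l\<bar> \<le> mat_norm_inf ?B * vec_norm_inf ?g"
    using l g by (intro abs_mult_mat_vec_le) (auto simp: B_step_def B_mat_def)
  also have "\<dots> \<le> C_B S * vec_norm_inf ?g"
    using velocity_on_time_grid[OF S N k] vec_norm_inf_nonneg[of ?g] g
    by (intro mult_right_mono) (auto simp: B_step_def C_B_def)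
  finally show ?thesis .
qed

text \<open>Read entrywise, the scheme equates an implicit half step of \<open>Y (k + 1)\<close> with an explicit half
  step of \<open>Y k\<close> plus a source. The two half steps may see different
  matrices, as the pump may be switched in between; each estimate needs only its own matrix.
  The source is the \<open>\<theta>\<close>-average of two vectors bounded by \<open>C_B S * b\<close>. The step size condition is in
  product form so that it includes \<open>\<theta> = 1\<close>, where it is trivial.\<close>

lemma theta_scheme_one_step:
  assumes S: "valid_heat_exchanger S" and N: "N \<ge> 1" and \<theta>: "0 \<le> \<theta>" "\<theta> \<le> 1"
    and cfl: "tau S N * (1 - \<theta>) * eta S \<le> 1"
    and sch: "theta_scheme S N \<theta> QI QG Y" and k: "k < N"
    and b: "vec_norm_inf (g_step S N QI QG k) \<le> b" "vec_norm_inf (g_step S N QI QG (k + 1)) \<le> b"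
  shows "vec_norm_inf (Y (k + 1)) \<le> vec_norm_inf (Y k) + tau S N * (C_B S * b)"
proof -
  let ?n = "n_unknowns S" and ?t = "tau S N" and ?v = "\<lambda>k. v0 S (time S N k)"
  let ?src = "\<lambda>k. B_step S N k *\<^sub>v g_step S N QI QG k"
  have t: "0 \<le> ?t" using S by (simp add: tau_def valid_heat_exchanger_def)
  have Y: "Y k \<in> carrier_vec ?n" "Y (k + 1) \<in> carrier_vec ?n"
    using sch k by (auto simp: theta_scheme_def)
  have A: "A_mat S v \<in> carrier_mat ?n ?n" for v by (simp add: A_mat_def)
  have v: "0 \<le> ?v m" "?v m \<le> v_bar S" if "m \<le> N" for m
    using velocity_on_time_grid[OF S N that] coefficient_positivity(5)[OF S] by auto
  have src: "\<bar>?src m $ l\<bar> \<le> C_B S * b" if "m \<in> {k, k + 1}" "l < ?n" for m l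
  proof -
    have "\<bar>?src m $ l\<bar> \<le> C_B S * vec_norm_inf (g_step S N QI QG m)"
      using that k by (intro abs_source_le[OF S N]) auto
    also have "\<dots> \<le> C_B S * b" using that b C_B_pos[OF S] by (intro mult_left_mono) auto
    finally show ?thesis .
  qed
  show ?thesis
  proof (rule implicit_half_step[OF S v Y(2), of "k + 1" "?t * \<theta>"])
    fix l assume l: "l < ?n"
    have F: "F_step S N \<theta> QI QG k $ l = \<theta> * ?src (k + 1) $ l + (1 - \<theta>) * ?src k $ l"
      using l by (simp add: F_step_def B_step_def B_mat_def)
    have Fl: "\<bar>F_step S N \<theta> QI QG k $ l\<bar> \<le> C_B S * b"
    proof -
      have "\<bar>\<theta> * ?src (k + 1) $ l + (1 - \<theta>) * ?src k $ l\<bar> \<le> C_B S * b"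
        using \<theta> src[of "k + 1" l] src[of k l] l by (intro abs_convex_combination_le) auto
      then show ?thesis by (simp only: F)
    qed
    have G: "(G_step S N \<theta> (k + 1) *\<^sub>v Y (k + 1)) $ l =
        Y (k + 1) $ l - ?t * \<theta> * (A_mat S (?v (k + 1)) *\<^sub>v Y (k + 1)) $ l"
      using l Y A[of "?v (k + 1)"]
      by (simp add: G_step_def A_step_def minus_mult_distrib_mat_vec[of _ ?n ?n])
    have H: "(H_step S N \<theta> k *\<^sub>v Y k) $ l =
        Y k $ l + ?t * (1 - \<theta>) * (A_mat S (?v k) *\<^sub>v Y k) $ l"
      using l Y A[of "?v k"]
      by (simp add: H_step_def A_step_def add_mult_distrib_mat_vec[of _ ?n ?n])
    have dims: "dim_vec (F_step S N \<theta> QI QG k) = ?n"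
      by (simp add: F_step_def B_step_def B_mat_def)
    have "(G_step S N \<theta> (k + 1) *\<^sub>v Y (k + 1)) $ l =
        (H_step S N \<theta> k *\<^sub>v Y k + ?t \<cdot>\<^sub>v F_step S N \<theta> QI QG k) $ l"
      using sch k by (simp add: theta_scheme_def)
    also have "\<dots> = (H_step S N \<theta> k *\<^sub>v Y k) $ l + ?t * F_step S N \<theta> QI QG k $ l"
      using l dims by simp
    finally have "Y (k + 1) $ l - ?t * \<theta> * (A_mat S (?v (k + 1)) *\<^sub>v Y (k + 1)) $ l =
        (Y k $ l + ?t * (1 - \<theta>) * (A_mat S (?v k) *\<^sub>v Y k) $ l) + ?t * F_step S N \<theta> QI QG k $ l"
      unfolding G H .
    also have "\<bar>\<dots>\<bar> \<le> vec_norm_inf (Y k) + ?t * (C_B S * b)"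
    proof (rule order_trans[OF abs_triangle_ineq], rule add_mono)
      show "\<bar>Y k $ l + ?t * (1 - \<theta>) * (A_mat S (?v k) *\<^sub>v Y k) $ l\<bar> \<le> vec_norm_inf (Y k)"
        using explicit_half_step[OF S v Y(1) l, of k "?t * (1 - \<theta>)"] k t \<theta> cfl by auto
      show "\<bar>?t * F_step S N \<theta> QI QG k $ l\<bar> \<le> ?t * (C_B S * b)"
        using Fl t by (simp add: abs_mult mult_left_mono)
    qed
    finally show "\<bar>Y (k + 1) $ l - ?t * \<theta> * (A_mat S (?v (k + 1)) *\<^sub>v Y (k + 1)) $ l\<bar>
        \<le> vec_norm_inf (Y k) + ?t * (C_B S * b)" .
  qed (use k t \<theta> in auto)
qed

lemma theta_scheme_stable:
  assumes S: "valid_heat_exchanger S" and N: "N \<ge> 1" and \<theta>: "0 \<le> \<theta>" "\<theta> \<le> 1"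
    and cfl: "tau S N * (1 - \<theta>) * eta S \<le> 1"
  shows "max_norm_stable_with S N \<theta> 1 (C_B S * horizon S)"
  unfolding max_norm_stable_with_def
proof (intro conjI allI impI ballI)
  have T: "0 < horizon S" using S by (simp add: valid_heat_exchanger_def)
  show "0 < C_B S * horizon S" using T C_B_pos[OF S] by simp
  fix QI QG :: "real \<Rightarrow> real" and Y k
  assume sch: "theta_scheme S N \<theta> QI QG Y" and k: "k \<in> {1..N}"
  let ?g = "\<lambda>j. vec_norm_inf (g_step S N QI QG j)"
  \<comment> \<open>one bound for the data up to time \<open>k\<close>, so that the same increment serves in every step\<close>
  define b where "b = Max (?g ` {0..k})"
  have b: "?g j \<le> b" if "j \<le> k" for j using that by (auto simp: b_def)
  have "0 \<le> ?g 0" by (rule vec_norm_inf_nonneg) (simp add: g_step_def g_vec_def)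
  then have b0: "0 \<le> b" using b[of 0] by simp
  have growth: "vec_norm_inf (Y m) \<le> vec_norm_inf (Y 0) + real m * tau S N * (C_B S * b)"
    if "m \<le> k" for m
    using that
  proof (induction m)
    case (Suc m)
    have "vec_norm_inf (Y (m + 1)) \<le> vec_norm_inf (Y m) + tau S N * (C_B S * b)"
      using Suc.prems k b by (intro theta_scheme_one_step[OF S N \<theta> cfl sch]) auto
    with Suc show ?case by (simp add: algebra_simps)
  qed simp
  have "real k * tau S N = (real k / real N) * horizon S" by (simp add: tau_def)
  also have "\<dots> \<le> 1 * horizon S" using k T by (intro mult_right_mono) auto
  finally have "real k * tau S N * (C_B S * b) \<le> horizon S * (C_B S * b)"
    using b0 C_B_pos[OF S] by (intro mult_right_mono) auto
  with growth[of k]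
  show "vec_norm_inf (Y k) \<le> 1 * vec_norm_inf (Y 0) + C_B S * horizon S * Max (?g ` {0..k})"
    by (simp add: b_def algebra_simps)
qed simp

theorem theorem4p2:
  fixes S :: heat_exchanger and N :: nat and \<theta> :: real
  assumes "valid_heat_exchanger S" and "N \<ge> 1"
  shows "(0 \<le> \<theta> \<and> \<theta> < 1 \<and> tau S N \<le> 1 / ((1 - \<theta>) * eta S) \<longrightarrow>
            max_norm_stable S N \<theta> \<and> max_norm_stable_with S N \<theta> 1 (C_B S * horizon S)) \<and>
         (\<theta> = 1 \<longrightarrow>
            max_norm_stable S N \<theta> \<and> max_norm_stable_with S N \<theta> 1 (C_B S * horizon S))"
proof -
  have "max_norm_stable_with S N \<theta> 1 (C_B S * horizon S)"
    if "0 \<le> \<theta>" "\<theta> < 1" "tau S N \<le> 1 / ((1 - \<theta>) * eta S)"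
  proof (rule theta_scheme_stable[OF assms])
    have "0 < (1 - \<theta>) * eta S" using that eta_pos[OF assms(1)] by simp
    with that(3) show "tau S N * (1 - \<theta>) * eta S \<le> 1"
      by (simp add: pos_le_divide_eq mult.assoc)
  qed (use that in auto)
  moreover have "max_norm_stable_with S N \<theta> 1 (C_B S * horizon S)" if "\<theta> = 1"
    using that by (intro theta_scheme_stable[OF assms]) auto
  ultimately show ?thesis by (auto simp: max_norm_stable_def)
qed

end
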